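(* Let $\mathcal{M}$ be a matroid (on a finite ground set) and let $k$ be a field. If the Kapranov rank over $k$ of the cocircuit matrix $\mathcal{C}(\mathcal{M})$ is equal to the rank of $\mathcal{M}$, then $\mathcal{M}$ is representable over $k$. If $k$ is an infinite field, then the converse also holds: if $\mathcal{M}$ is representable over $k$, then the Kapranov rank of $\mathcal{C}(\mathcal{M})$ over $k$ equals the rank of $\mathcal{M}$.
   Context: The cocircuit matrix $\mathcal{C}(\mathcal{M})$ has rows indexed by the elements of the ground set of $\mathcal{M}$ and columns indexed by the cocircuits of $\mathcal{M}$; its $(i,j)$ entry is $0$ if the $i$-th element is in the $j$-th cocircuit and $1$ otherwise. Kapranov rank over $k$: let $\tilde K$ be the field of formal power series $f=\sum_a c_a t^a$ with coefficients in $k$ and real exponents, with well-ordered support; for $f\neq0$, $\deg(f)$ is the smallest exponent $a$ with $c_a\ne0$. A tropical linear space over $k$ in $\mathbb{R}^d$ is the image under coordinatewise $\deg$ of a linear subspace $V$ of the $\tilde K$-vector space $\tilde K^d$, i.e. a set $\{(\deg f_1,\dots,\deg f_d):(f_1,\dots,f_d)\in V,\ \text{all }f_i\ne0\}$; its dimension is $\dim_{\tilde K}V$. The Kapranov rank over $k$ of a matrix in $\mathbb{R}^{d\times n}$ is the smallest dimension of a tropical linear space over $k$ in $\mathbb{R}^d$ containing all its columns. Equivalently, it is the smallest rank over $\tilde K$ of a matrix $F$ with non-zero entries in $\tilde K$ whose entrywise degree is the given matrix. *)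

theory Defs
  imports Complex_Main "HOL-Library.Function_Algebras" "HOL-Library.FuncSet"
begin

section \<open>Well-ordered sets of reals\<close>

text \<open>As the reals are linearly ordered, well-foundedness of \<open><\<close> on a set says that the set is
  well-ordered.\<close>

abbreviation well_ordered :: "real set \<Rightarrow> bool" where
  "well_ordered S \<equiv> wfp_on S (<)"

lemma well_ordered_iff:
  "well_ordered S \<longleftrightarrow> (\<forall>B\<subseteq>S. B \<noteq> {} \<longrightarrow> (\<exists>m\<in>B. \<forall>x\<in>B. m \<le> x))"
  unfolding wfp_on_iff_ex_minimal by (meson not_le)

lemma well_ordered_min:
  assumes "well_ordered S" "B \<subseteq> S" "B \<noteq> {}"
  obtains m where "m \<in> B" "\<And>x. x \<in> B \<Longrightarrow> m \<le> x"
  using assms unfolding well_ordered_iff by meson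

lemma well_ordered_singleton: "well_ordered {x}"
  by (simp add: wfp_on_def)

lemma well_ordered_incseq:
  assumes S: "well_ordered S" and s: "\<And>n. s n \<in> S"
  obtains r :: "nat \<Rightarrow> nat" where "strict_mono r" "incseq (\<lambda>n. s (r n))"
proof -
  obtain r where r: "strict_mono r" "monoseq (\<lambda>n. s (r n))"
    using seq_monosub by blast
  show ?thesis
  proof (cases "incseq (\<lambda>n. s (r n))")
    case True
    with r that show ?thesis by blast
  next
    case False
    then have dec: "\<And>m n. m \<le> n \<Longrightarrow> s (r n) \<le> s (r m)"
      using r(2) unfolding monoseq_def monotone_def by blast
    have "range (\<lambda>n. s (r n)) \<subseteq> S" "range (\<lambda>n. s (r n)) \<noteq> {}" using s by auto
    then obtain z where "z \<in> range (\<lambda>n. s (r n))" "\<forall>x\<in>range (\<lambda>n. s (r n)). z \<le> x"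
      by (meson well_ordered_min[OF S])
    then obtain m where m: "\<And>n. s (r m) \<le> s (r n)" by blast
    have "s (r (n + m)) = s (r m)" for n
      using m[of "n + m"] dec[of m "n + m"] by simp
    then have "incseq (\<lambda>n. s (r (n + m)))" by (simp add: monotone_def)
    moreover have "strict_mono (\<lambda>n. r (n + m))" using r(1) by (simp add: strict_mono_def)
    ultimately show ?thesis using that by blast
  qed
qed

lemma well_orderedI:
  assumes "\<And>s::nat \<Rightarrow> real. (\<And>n. s n \<in> S) \<Longrightarrow> (\<And>n. s (Suc n) < s n) \<Longrightarrow> False"
  shows "well_ordered S"
proof (rule ccontr)
  assume "\<not> well_ordered S"
  then obtain B where B: "B \<subseteq> S" "B \<noteq> {}" "\<forall>m\<in>B. \<exists>x\<in>B. x < m"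
    unfolding well_ordered_iff by (meson not_le)
  then have "\<exists>s. \<forall>n::nat. s n \<in> B \<and> s (Suc n) < s n"
    by (intro dependent_nat_choice) auto
  then show False using assms B(1) by blast
qed

lemma well_ordered_Un:
  assumes "well_ordered S" "well_ordered T"
  shows "well_ordered (S \<union> T)"
  unfolding well_ordered_iff
proof (intro allI impI)
  fix B assume B: "B \<subseteq> S \<union> T" "B \<noteq> {}"
  show "\<exists>m\<in>B. \<forall>x\<in>B. m \<le> x"
  proof (cases "B \<inter> S = {} \<or> B \<inter> T = {}")
    case True
    then have "B \<subseteq> T \<or> B \<subseteq> S" using B(1) by blast
    then show ?thesis using assms B(2) by (meson well_ordered_min)
  next
    case False
    then obtain m n where m: "m \<in> B \<inter> S" "\<And>x. x \<in> B \<inter> S \<Longrightarrow> m \<le> x"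
      and n: "n \<in> B \<inter> T" "\<And>x. x \<in> B \<inter> T \<Longrightarrow> n \<le> x"
      using well_ordered_min[OF assms(1) Int_lower2] well_ordered_min[OF assms(2) Int_lower2]
      by metis
    show ?thesis
    proof (intro bexI ballI)
      show "min m n \<in> B" using m(1) n(1) by (simp add: min_def)
      fix x assume "x \<in> B"
      then have "x \<in> B \<inter> S \<or> x \<in> B \<inter> T" using B(1) by blast
      then show "min m n \<le> x" using m(2)[of x] n(2)[of x] by linarith
    qed
  qed
qed

lemma sumsetI:
  fixes a x :: real
  assumes "a \<in> S" "x - a \<in> T"
  shows "x \<in> {a + b | a b. a \<in> S \<and> b \<in> T}"
proof -
  have "x = a + (x - a)" by simp
  with assms show ?thesis by blast
qed

lemma well_ordered_sumset:
  assumes "well_ordered S" "well_ordered T"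
  shows "well_ordered {a + b | a b. a \<in> S \<and> b \<in> T}"
proof (rule well_orderedI)
  fix s :: "nat \<Rightarrow> real"
  assume "\<And>n. s n \<in> {a + b | a b. a \<in> S \<and> b \<in> T}" and dec: "\<And>n. s (Suc n) < s n"
  then have "\<forall>n. \<exists>a b. a \<in> S \<and> b \<in> T \<and> s n = a + b" by blast
  then obtain a b where ab: "\<And>n. a n \<in> S" "\<And>n. b n \<in> T" "\<And>n. s n = a n + b n"
    by metis
  obtain r where r: "strict_mono r" "incseq (\<lambda>n. a (r n))"
    using well_ordered_incseq[OF assms(1), of a] ab by blast
  obtain q where q: "strict_mono q" "incseq (\<lambda>n. b (r (q n)))"
    using well_ordered_incseq[OF assms(2), of "\<lambda>n. b (r n)"] ab by blast
  have "a (r (q 0)) \<le> a (r (q 1))"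
    using r(2) q(1) by (simp add: incseq_def strict_mono_def less_imp_le)
  moreover have "b (r (q 0)) \<le> b (r (q 1))" using q(2) by (simp add: incseq_def)
  moreover have "s (r (q 1)) < s (r (q 0))"
  proof -
    have "r (q 0) < r (q 1)" using r(1) q(1) by (simp add: strict_mono_def)
    then show ?thesis using dec by (rule lift_Suc_mono_less[of "\<lambda>n. - s n", simplified, rotated])
  qed
  ultimately show False using ab(3) by simp
qed

lemma finite_convolution:
  fixes x :: real
  assumes "well_ordered S" "well_ordered T"
  shows "finite {a \<in> S. x - a \<in> T}"
proof (rule ccontr)
  assume "infinite {a \<in> S. x - a \<in> T}"
  then obtain s :: "nat \<Rightarrow> real" where inj: "inj s" and s: "range s \<subseteq> {a \<in> S. x - a \<in> T}"
    using infinite_countable_subset by blast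
  have sS: "\<And>n. s n \<in> S" and sT: "\<And>n. x - s n \<in> T" using s by auto
  obtain r where r: "strict_mono r" "incseq (\<lambda>n. s (r n))"
    using well_ordered_incseq[OF assms(1), of s] sS by blast
  obtain q where q: "strict_mono q" "incseq (\<lambda>n. x - s (r (q n)))"
    using well_ordered_incseq[OF assms(2), of "\<lambda>n. x - s (r n)"] sT by blast
  have lt: "r (q 0) < r (q 1)" using r(1) q(1) by (simp add: strict_mono_def)
  have "s (r (q 0)) \<le> s (r (q 1))"
    using r(2) q(1) by (simp add: incseq_def strict_mono_def less_imp_le)
  moreover have "s (r (q 1)) \<le> s (r (q 0))" using q(2) by (force simp: incseq_def)
  ultimately have "s (r (q 0)) = s (r (q 1))" by (rule order_antisym)
  then show False using lt injD[OF inj] by force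
qed

text \<open>The additive monoid generated by a set.\<close>

inductive_set add_monoid :: "real set \<Rightarrow> real set" for A where
  zero: "0 \<in> add_monoid A"
| plus: "a \<in> A \<Longrightarrow> b \<in> add_monoid A \<Longrightarrow> a + b \<in> add_monoid A"

lemma well_ordered_add_monoid:
  assumes A: "well_ordered A" and pos: "\<And>a. a \<in> A \<Longrightarrow> 0 < a"
  shows "well_ordered (add_monoid A)"
proof (cases "A = {}")
  case True
  have "x = 0" if "x \<in> add_monoid A" for x
    using that by induction (use True in auto)
  then have "add_monoid A \<subseteq> {0}" by blast
  then show ?thesis by (rule wfp_on_subset[OF well_ordered_singleton])
next
  case False
  then obtain m where m: "m \<in> A" "\<And>x. x \<in> A \<Longrightarrow> m \<le> x"
    using well_ordered_min[OF A order_refl] by metis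
  have m0: "m > 0" using m pos by blast
  define L where "L = rec_nat {0::real} (\<lambda>_ X. X \<union> {a + b | a b. a \<in> A \<and> b \<in> X})"
  have L0: "L 0 = {0}" and LS: "\<And>n. L (Suc n) = L n \<union> {a + b | a b. a \<in> A \<and> b \<in> L n}"
    by (simp_all add: L_def)
  have woL: "well_ordered (L n)" for n
  proof (induction n)
    case 0 show ?case unfolding L0 by (rule well_ordered_singleton)
  next
    case (Suc n) then show ?case unfolding LS
      by (intro well_ordered_Un well_ordered_sumset A)
  qed
  have mono: "L k \<subseteq> L n" if "k \<le> n" for k n
    using that by (rule lift_Suc_mono_le[of L, rotated]) (auto simp: LS)
  have key: "\<exists>k. x \<in> L k \<and> real k * m \<le> x" if "x \<in> add_monoid A" for x
    using that
  proof induction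
    case zero show ?case using L0 by (intro exI[of _ 0]) auto
  next
    case (plus a b)
    then obtain k where "b \<in> L k" "real k * m \<le> b" by blast
    then show ?case using m(2)[OF plus(1)] plus(1)
      by (intro exI[of _ "Suc k"]) (auto simp: LS algebra_simps)
  qed
  show ?thesis
  proof (rule well_orderedI)
    fix s :: "nat \<Rightarrow> real" assume s: "\<And>n. s n \<in> add_monoid A" and dec: "\<And>n. s (Suc n) < s n"
    obtain N :: nat where N: "s 0 / m < real N" using reals_Archimedean2 by blast
    have le0: "s n \<le> s 0" for n
      using dec by (induction n) (auto intro: less_imp_le order_trans)
    have sN: "s n \<in> L N" for n
    proof -
      obtain k where k: "s n \<in> L k" "real k * m \<le> s n" using key s by blast
      have "real k * m \<le> s 0" using k(2) le0 by (rule order_trans)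
      then have "real k \<le> s 0 / m" using m0 by (simp add: field_simps)
      then have "k \<le> N" using N by linarith
      then show ?thesis using k(1) mono by blast
    qed
    obtain r where r: "strict_mono r" "incseq (\<lambda>n. s (r n))"
      using well_ordered_incseq[OF woL[of N], of s] sN by blast
    have "s (r 0) \<le> s (r 1)" using r(2) by (simp add: incseq_def)
    moreover have "r 0 < r 1" using r(1) by (simp add: strict_mono_def)
    then have "s (r 1) < s (r 0)"
      using dec by (rule lift_Suc_mono_less[of "\<lambda>n. - s n", simplified, rotated])
    ultimately show False by simp
  qed
qed


section \<open>Formal power series with real exponents and well-ordered support\<close>

typedef (overloaded) 'a hahn = "{f :: real \<Rightarrow> 'a::zero. well_ordered {a. f a \<noteq> 0}}"
  morphisms hahn_coeff Abs_hahn
  by (rule exI[of _ "\<lambda>_. 0"]) (simp add: wfp_on_def)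

setup_lifting type_definition_hahn

definition hahn_supp :: "'a::zero hahn \<Rightarrow> real set" where
  "hahn_supp f = {a. hahn_coeff f a \<noteq> 0}"

lemma well_ordered_hahn_supp: "well_ordered (hahn_supp f)"
  using hahn_coeff[of f] by (simp add: hahn_supp_def)

lemma hahn_eqI: "(\<And>a. hahn_coeff f a = hahn_coeff g a) \<Longrightarrow> f = g"
  by (meson ext hahn_coeff_inject)

text \<open>The smallest exponent; unspecified for the zero series.\<close>

definition hahn_deg :: "'a::zero hahn \<Rightarrow> real" where
  "hahn_deg f = (LEAST a. hahn_coeff f a \<noteq> 0)"

instantiation hahn :: (zero) zero
begin
lift_definition zero_hahn :: "'a hahn" is "\<lambda>_. 0" by (simp add: wfp_on_def)
instance ..
end

instantiation hahn :: (ab_group_add) ab_group_add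
begin

lift_definition plus_hahn :: "'a hahn \<Rightarrow> 'a hahn \<Rightarrow> 'a hahn" is "\<lambda>f g a. f a + g a"
  by (erule (1) wfp_on_subset[OF well_ordered_Un]) auto

lift_definition uminus_hahn :: "'a hahn \<Rightarrow> 'a hahn" is "\<lambda>f a. - f a" by simp

lift_definition minus_hahn :: "'a hahn \<Rightarrow> 'a hahn \<Rightarrow> 'a hahn" is "\<lambda>f g a. f a - g a"
  by (erule (1) wfp_on_subset[OF well_ordered_Un]) auto

instance
  by standard (transfer; simp add: fun_eq_iff algebra_simps)+

end

lemmas hahn_coeff_simps [simp] = zero_hahn.rep_eq plus_hahn.rep_eq uminus_hahn.rep_eq minus_hahn.rep_eq

instantiation hahn :: (comm_ring_1) comm_ring_1
begin

lift_definition one_hahn :: "'a hahn" is "\<lambda>a. if a = 0 then 1 else 0"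
  by (rule wfp_on_subset[OF well_ordered_singleton[of 0]]) auto

lift_definition times_hahn :: "'a hahn \<Rightarrow> 'a hahn \<Rightarrow> 'a hahn" is
  "\<lambda>f g x. \<Sum>a | f a \<noteq> 0 \<and> g (x - a) \<noteq> 0. f a * g (x - a)"
proof -
  fix f g :: "real \<Rightarrow> 'a"
  assume wo: "well_ordered {a. f a \<noteq> 0}" "well_ordered {a. g a \<noteq> 0}"
  show "well_ordered {x. (\<Sum>a | f a \<noteq> 0 \<and> g (x - a) \<noteq> 0. f a * g (x - a)) \<noteq> 0}"
  proof (rule wfp_on_subset[OF well_ordered_sumset[OF wo]], rule subsetI)
    fix x assume "x \<in> {x. (\<Sum>a | f a \<noteq> 0 \<and> g (x - a) \<noteq> 0. f a * g (x - a)) \<noteq> 0}"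
    then have "(\<Sum>a | f a \<noteq> 0 \<and> g (x - a) \<noteq> 0. f a * g (x - a)) \<noteq> 0" by blast
    then obtain a where "f a \<noteq> 0" "g (x - a) \<noteq> 0" by (rule sum.not_neutral_contains_not_neutral) blast
    then show "x \<in> {a + b |a b. a \<in> {a. f a \<noteq> 0} \<and> b \<in> {a. g a \<noteq> 0}}"
      by (intro sumsetI) simp_all
  qed
qed

lemma hahn_coeff_times: \<comment> \<open>any finite set containing the relevant exponents may be summed over\<close>
  fixes f g :: "'a hahn"
  assumes "finite A" "{a \<in> hahn_supp f. x - a \<in> hahn_supp g} \<subseteq> A"
  shows "hahn_coeff (f * g) x = (\<Sum>a\<in>A. hahn_coeff f a * hahn_coeff g (x - a))"
  unfolding times_hahn.rep_eq using assms
  by (intro sum.mono_neutral_left) (auto simp: hahn_supp_def)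

instance
proof
  fix f g h :: "'a hahn"
  let ?S = "hahn_supp f" and ?T = "hahn_supp g" and ?U = "hahn_supp h"
  note wo = well_ordered_hahn_supp[of f] well_ordered_hahn_supp[of g] well_ordered_hahn_supp[of h]
  note fin = finite_convolution[OF well_ordered_hahn_supp well_ordered_hahn_supp]
  show "f * g * h = f * (g * h)"
  proof (rule hahn_eqI)
    fix x
    define A where "A = {a \<in> {a + b | a b. a \<in> ?S \<and> b \<in> ?T}. x - a \<in> ?U}"
    define B where "B = {b \<in> ?S. x - b \<in> {a + b | a b. a \<in> ?T \<and> b \<in> ?U}}"
    have A: "finite A" unfolding A_def
      by (rule finite_convolution[OF well_ordered_sumset[OF wo(1,2)] wo(3)])
    have B: "finite B" unfolding B_def
      by (rule finite_convolution[OF wo(1) well_ordered_sumset[OF wo(2,3)]])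
    have supp: "hahn_supp (u * v) \<subseteq> {a + b | a b. a \<in> hahn_supp u \<and> b \<in> hahn_supp v}" for u v :: "'a hahn"
    proof
      fix y assume "y \<in> hahn_supp (u * v)"
      then have "(\<Sum>a | hahn_coeff u a \<noteq> 0 \<and> hahn_coeff v (y - a) \<noteq> 0.
          hahn_coeff u a * hahn_coeff v (y - a)) \<noteq> 0"
        by (simp add: hahn_supp_def times_hahn.rep_eq)
      then obtain a where "a \<in> hahn_supp u" "y - a \<in> hahn_supp v"
        unfolding hahn_supp_def by (rule sum.not_neutral_contains_not_neutral) blast
      then show "y \<in> {a + b | a b. a \<in> hahn_supp u \<and> b \<in> hahn_supp v}"
        by (rule sumsetI)
    qed
    have 1: "hahn_coeff (f * g) a = (\<Sum>b\<in>B. hahn_coeff f b * hahn_coeff g (a - b))" if "a \<in> A" for a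
    proof (rule hahn_coeff_times[OF B], rule subsetI)
      fix b assume b: "b \<in> {b \<in> ?S. a - b \<in> ?T}"
      have "x - b = (a - b) + (x - a)" by simp
      then show "b \<in> B" using b that unfolding A_def B_def by blast
    qed
    have 2: "hahn_coeff (g * h) (x - b) = (\<Sum>a\<in>A. hahn_coeff g (a - b) * hahn_coeff h (x - a))" if "b \<in> B" for b
    proof -
      have "hahn_coeff (g * h) (x - b)
          = (\<Sum>c\<in>(\<lambda>a. a - b) ` A. hahn_coeff g c * hahn_coeff h (x - b - c))"
      proof (rule hahn_coeff_times, use A in simp, rule subsetI)
        fix c assume c: "c \<in> {c \<in> ?T. x - b - c \<in> ?U}"
        have "b \<in> ?S" "c \<in> ?T" using c that unfolding B_def by blast+
        moreover have "x - (b + c) \<in> ?U" using c by (simp add: diff_diff_eq)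
        ultimately have "b + c \<in> A" unfolding A_def by blast
        then show "c \<in> (\<lambda>a. a - b) ` A" by (metis add_diff_cancel_left' image_eqI)
      qed
      also have "\<dots> = (\<Sum>a\<in>A. hahn_coeff g (a - b) * hahn_coeff h (x - a))"
        by (subst sum.reindex) (auto simp: inj_on_def)
      finally show ?thesis .
    qed
    have "hahn_coeff (f * g * h) x = (\<Sum>a\<in>A. hahn_coeff (f * g) a * hahn_coeff h (x - a))"
      by (rule hahn_coeff_times[OF A]) (use supp[of f g] in \<open>auto simp: A_def\<close>)
    also have "\<dots> = (\<Sum>a\<in>A. \<Sum>b\<in>B. hahn_coeff f b * (hahn_coeff g (a - b) * hahn_coeff h (x - a)))"
      by (rule sum.cong) (simp_all add: 1 sum_distrib_right mult.assoc)
    also have "\<dots> = (\<Sum>b\<in>B. \<Sum>a\<in>A. hahn_coeff f b * (hahn_coeff g (a - b) * hahn_coeff h (x - a)))"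
      by (rule sum.swap)
    also have "\<dots> = (\<Sum>b\<in>B. hahn_coeff f b * hahn_coeff (g * h) (x - b))"
      by (rule sum.cong) (simp_all add: 2 sum_distrib_left)
    also have "\<dots> = hahn_coeff (f * (g * h)) x"
      by (rule hahn_coeff_times[OF B, symmetric]) (use supp[of g h] in \<open>auto simp: B_def\<close>)
    finally show "hahn_coeff (f * g * h) x = hahn_coeff (f * (g * h)) x" .
  qed
  show "f * g = g * f"
  proof (rule hahn_eqI)
    fix x
    show "hahn_coeff (f * g) x = hahn_coeff (g * f) x"
      unfolding times_hahn.rep_eq
      by (rule sum.reindex_bij_witness[of _ "\<lambda>a. x - a" "\<lambda>a. x - a"]) (auto simp: mult.commute)
  qed
  show "1 * f = f"
  proof (rule hahn_eqI)
    fix x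
    have "hahn_coeff (1 * f) x = (\<Sum>a\<in>{0}. hahn_coeff 1 a * hahn_coeff f (x - a))"
      by (rule hahn_coeff_times) (auto simp: hahn_supp_def one_hahn.rep_eq split: if_splits)
    then show "hahn_coeff (1 * f) x = hahn_coeff f x" by (simp add: one_hahn.rep_eq)
  qed
  show "(f + g) * h = f * h + g * h"
  proof (rule hahn_eqI)
    fix x
    define A where "A = {a \<in> ?S. x - a \<in> ?U} \<union> {a \<in> ?T. x - a \<in> ?U}"
    have A: "finite A" unfolding A_def using fin by blast
    have "hahn_coeff ((f + g) * h) x = (\<Sum>a\<in>A. hahn_coeff (f + g) a * hahn_coeff h (x - a))"
      by (rule hahn_coeff_times[OF A]) (auto simp: A_def hahn_supp_def)
    also have "\<dots> = (\<Sum>a\<in>A. hahn_coeff f a * hahn_coeff h (x - a))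
        + (\<Sum>a\<in>A. hahn_coeff g a * hahn_coeff h (x - a))"
      by (simp add: sum.distrib distrib_right)
    also have "\<dots> = hahn_coeff (f * h + g * h) x"
      using hahn_coeff_times[OF A, of f x h] hahn_coeff_times[OF A, of g x h] by (simp add: A_def)
    finally show "hahn_coeff ((f + g) * h) x = hahn_coeff (f * h + g * h) x" .
  qed
  show "(0::'a hahn) \<noteq> 1"
    by (metis one_hahn.rep_eq zero_hahn.rep_eq zero_neq_one)
qed

end

text \<open>The monomial \<open>c t\<^sup>d\<close>.\<close>

lift_definition hahn_monom :: "'a::zero \<Rightarrow> real \<Rightarrow> 'a hahn" is "\<lambda>c d a. if a = d then c else 0"
proof -
  fix c :: 'a and d :: real
  show "well_ordered {a. (if a = d then c else 0) \<noteq> 0}"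
    by (rule wfp_on_subset[OF well_ordered_singleton[of d]]) auto
qed

lemma hahn_coeff_monom_times:
  fixes f :: "'a::comm_ring_1 hahn"
  shows "hahn_coeff (hahn_monom c d * f) x = c * hahn_coeff f (x - d)"
proof -
  have "hahn_coeff (hahn_monom c d * f) x = (\<Sum>a\<in>{d}. hahn_coeff (hahn_monom c d) a * hahn_coeff f (x - a))"
    by (rule hahn_coeff_times) (auto simp: hahn_supp_def hahn_monom.rep_eq split: if_splits)
  then show ?thesis by (simp add: hahn_monom.rep_eq)
qed

lemma hahn_inverse_unipotent:
  fixes f :: "'a::comm_ring_1 hahn"
  assumes f0: "hahn_coeff f 0 = 1" and neg: "\<And>a. a < 0 \<Longrightarrow> hahn_coeff f a = 0"
  shows "\<exists>g. f * g = 1"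
proof -
  define A where "A = hahn_supp f - {0}"
  define S where "S = add_monoid A"
  have A: "well_ordered A" unfolding A_def
    by (rule wfp_on_subset[OF well_ordered_hahn_supp]) auto
  have pos: "0 < a" if "a \<in> A" for a
    using that neg[of a] by (auto simp: A_def hahn_supp_def) (meson linorder_cases)
  have S: "well_ordered S" unfolding S_def by (rule well_ordered_add_monoid[OF A pos])
  have Sge: "0 \<le> x" if "x \<in> S" for x
    using that unfolding S_def by induction (auto dest: pos)
  define r where "r = {(y, x). y < x \<and> x \<in> S \<and> y \<in> S}"
  have "wf r"
  proof (rule wfI_min)
    fix x :: real and Q assume "x \<in> Q"
    show "\<exists>z\<in>Q. \<forall>y. (y, z) \<in> r \<longrightarrow> y \<notin> Q"
    proof (cases "Q \<inter> S = {}")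
      case True then show ?thesis using \<open>x \<in> Q\<close> by (auto simp: r_def)
    next
      case False
      then obtain m where "m \<in> Q \<inter> S" "\<And>y. y \<in> Q \<inter> S \<Longrightarrow> m \<le> y"
        using well_ordered_min[OF S Int_lower2] by blast
      then show ?thesis unfolding r_def by (intro bexI[of _ m]) fastforce+
    qed
  qed
  define H where "H = (\<lambda>u x. if x \<in> S then if x = 0 then 1
    else - (\<Sum>b | b \<in> A \<and> x - b \<in> S. hahn_coeff f b * u (x - b)) else (0::'a))"
  define G where "G = wfrec r H"
  have Grec: "G x = H (cut G r x) x" for x
    unfolding G_def by (rule wfrec[OF \<open>wf r\<close>])
  have G: "G x = H G x" for x
  proof -
    have "H (cut G r x) x = H G x"
      unfolding H_def using pos
      by (auto intro!: sum.cong simp: cut_apply r_def)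
    then show ?thesis using Grec by simp
  qed
  have suppG: "{x. G x \<noteq> 0} \<subseteq> S" using G by (auto simp: H_def)
  define g where "g = Abs_hahn G"
  have g: "hahn_coeff g = G"
    unfolding g_def by (rule Abs_hahn_inverse) (use wfp_on_subset[OF S suppG] in simp)
  have "f * g = 1"
  proof (rule hahn_eqI)
    fix x
    let ?B = "{b. b \<in> A \<and> x - b \<in> S}"
    have fin: "finite ?B" using finite_convolution[OF A S] .
    have "hahn_coeff (f * g) x = (\<Sum>b\<in>insert 0 ?B. hahn_coeff f b * hahn_coeff g (x - b))"
      by (rule hahn_coeff_times) (use fin suppG in \<open>auto simp: hahn_supp_def A_def g\<close>)
    also have "\<dots> = G x + (\<Sum>b\<in>?B. hahn_coeff f b * G (x - b))"
      using fin by (subst sum.insert) (auto simp: A_def g f0)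
    also have "\<dots> = (if x = 0 then 1 else 0)"
    proof (cases "x \<in> S")
      case False
      have "?B = {}"
      proof (rule ccontr)
        assume "?B \<noteq> {}"
        then obtain b where "b \<in> A" "x - b \<in> S" by blast
        then have "b + (x - b) \<in> S" unfolding S_def by (rule add_monoid.plus)
        then show False using False by simp
      qed
      moreover have "x \<noteq> 0" using False add_monoid.zero[of A] unfolding S_def by metis
      moreover have "G x = 0" using False suppG by blast
      ultimately show ?thesis by (simp only: sum.empty) simp
    next
      case True
      show ?thesis
      proof (cases "x = 0")
        case True
        have "?B = {}"
        proof (rule ccontr)
          assume "?B \<noteq> {}"
          then obtain b where "b \<in> A" "x - b \<in> S" by blast
          then show False using pos[of b] Sge[of "x - b"] True by simp
        qed
        then show ?thesis using \<open>x \<in> S\<close> True G[of x] unfolding H_def by (simp only: sum.empty) simp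
      next
        case False
        then show ?thesis using \<open>x \<in> S\<close> G[of x] unfolding H_def by simp
      qed
    qed
    finally show "hahn_coeff (f * g) x = hahn_coeff 1 x" by (simp add: one_hahn.rep_eq)
  qed
  then show ?thesis by blast
qed

lemma hahn_deg_supp: "f \<noteq> 0 \<Longrightarrow> hahn_coeff f (hahn_deg f) \<noteq> 0"
  and hahn_deg_le: "hahn_coeff f a \<noteq> 0 \<Longrightarrow> hahn_deg f \<le> a"
proof -
  have *: "hahn_coeff f (hahn_deg f) \<noteq> 0 \<and> (\<forall>a. hahn_coeff f a \<noteq> 0 \<longrightarrow> hahn_deg f \<le> a)"
    if "\<exists>a. hahn_coeff f a \<noteq> 0"
  proof -
    have "hahn_supp f \<noteq> {}" using that by (simp add: hahn_supp_def)
    then obtain m where "m \<in> hahn_supp f" "\<And>a. a \<in> hahn_supp f \<Longrightarrow> m \<le> a"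
      using well_ordered_min[OF well_ordered_hahn_supp order_refl] by blast
    then have m: "hahn_coeff f m \<noteq> 0" "\<And>a. hahn_coeff f a \<noteq> 0 \<Longrightarrow> m \<le> a"
      by (auto simp: hahn_supp_def)
    then have "hahn_deg f = m" unfolding hahn_deg_def by (rule Least_equality)
    then show ?thesis using m by blast
  qed
  show "f \<noteq> 0 \<Longrightarrow> hahn_coeff f (hahn_deg f) \<noteq> 0"
    using * by (metis hahn_eqI zero_hahn.rep_eq)
  show "hahn_coeff f a \<noteq> 0 \<Longrightarrow> hahn_deg f \<le> a" using * by blast
qed

lemma hahn_inverse_exists:
  fixes f :: "'a::field hahn"
  assumes "f \<noteq> 0"
  shows "\<exists>g. f * g = 1"
proof -
  let ?c = "hahn_coeff f (hahn_deg f)"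
  let ?m = "hahn_monom (inverse ?c) (- hahn_deg f)"
  have "\<exists>g. ?m * f * g = 1"
  proof (rule hahn_inverse_unipotent)
    show "hahn_coeff (?m * f) 0 = 1"
      using hahn_deg_supp[OF assms] by (simp add: hahn_coeff_monom_times)
    show "hahn_coeff (?m * f) a = 0" if "a < 0" for a
      using hahn_deg_le[of f "a + hahn_deg f"] that by (fastforce simp: hahn_coeff_monom_times)
  qed
  then show ?thesis by (metis mult.assoc mult.commute)
qed

instantiation hahn :: (field) field
begin

definition inverse_hahn :: "'a hahn \<Rightarrow> 'a hahn" where
  "inverse_hahn f = (if f = 0 then 0 else SOME g. f * g = 1)"

definition divide_hahn :: "'a hahn \<Rightarrow> 'a hahn \<Rightarrow> 'a hahn" where
  "divide_hahn f g = f * inverse g"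

instance
proof
  fix f g :: "'a hahn"
  show "f \<noteq> 0 \<Longrightarrow> inverse f * f = 1"
    using someI_ex[OF hahn_inverse_exists[of f]] by (simp add: inverse_hahn_def mult.commute)
  show "f div g = f * inverse g" by (rule divide_hahn_def)
  show "inverse (0::'a hahn) = 0" by (simp add: inverse_hahn_def)
qed

end


section \<open>Coordinate spaces\<close>

definition vscale :: "'k::field \<Rightarrow> ('i \<Rightarrow> 'k) \<Rightarrow> 'i \<Rightarrow> 'k" where
  "vscale c f = (\<lambda>i. c * f i)"

global_interpretation fvec: vector_space "vscale :: 'k::field \<Rightarrow> ('i \<Rightarrow> 'k) \<Rightarrow> 'i \<Rightarrow> 'k"
  by standard (simp_all add: vscale_def fun_eq_iff algebra_simps)

text \<open>The space \<open>k\<^sup>I\<close>; functions are fixed to be \<open>0\<close> outside of the index set \<open>I\<close>.\<close>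

definition coord_space :: "'i set \<Rightarrow> ('i \<Rightarrow> 'k::field) set" where
  "coord_space I = {f. \<forall>i. i \<notin> I \<longrightarrow> f i = 0}"


section \<open>Tropical linear spaces and Kapranov rank\<close>

text \<open>Points of \<open>\<real>\<^sup>I\<close> are functions that are \<^const>\<open>undefined\<close> outside of \<open>I\<close>.\<close>

definition tropicalization :: "'i set \<Rightarrow> ('i \<Rightarrow> 'k::field hahn) set \<Rightarrow> ('i \<Rightarrow> real) set" where
  "tropicalization I V = {\<lambda>i\<in>I. hahn_deg (f i) | f. f \<in> V \<and> (\<forall>i\<in>I. f i \<noteq> 0)}"

text \<open>\<open>L\<close> is a tropical linear space over \<open>'k\<close> in \<open>\<real>\<^sup>I\<close> that arises from a linear subspace of
  dimension \<open>n\<close>.\<close>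

definition tropical_linear_space ::
    "'k::field itself \<Rightarrow> 'i set \<Rightarrow> nat \<Rightarrow> ('i \<Rightarrow> real) set \<Rightarrow> bool" where
  "tropical_linear_space _ I n L \<longleftrightarrow>
     (\<exists>V :: ('i \<Rightarrow> 'k hahn) set.
        fvec.subspace V \<and> V \<subseteq> coord_space I \<and> fvec.dim V = n \<and> L = tropicalization I V)"

text \<open>The matrix \<open>A\<close> has rows indexed by \<open>I\<close> (assumed finite) and columns indexed by \<open>J\<close>.\<close>

definition kapranov_rank ::
    "'k::field itself \<Rightarrow> 'i set \<Rightarrow> 'j set \<Rightarrow> ('i \<Rightarrow> 'j \<Rightarrow> real) \<Rightarrow> nat" where
  "kapranov_rank k I J A =
     (LEAST n. \<exists>L. tropical_linear_space k I n L \<and> (\<forall>j\<in>J. (\<lambda>i\<in>I. A i j) \<in> L))"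


section \<open>Matroids\<close>

locale matroid =
  fixes E :: "'a set" and indep :: "'a set \<Rightarrow> bool"
  assumes finite_ground: "finite E"
    and indep_subset_ground: "indep X \<Longrightarrow> X \<subseteq> E"
    and indep_empty: "indep {}"
    and indep_subset: "indep X \<Longrightarrow> Y \<subseteq> X \<Longrightarrow> indep Y"
    and augmentation:
      "indep X \<Longrightarrow> indep Y \<Longrightarrow> card X < card Y \<Longrightarrow> \<exists>y\<in>Y - X. indep (insert y X)"

definition matroid_rank :: "('a set \<Rightarrow> bool) \<Rightarrow> nat" where
  "matroid_rank indep = Max (card ` {X. indep X})"

definition matroid_basis :: "('a set \<Rightarrow> bool) \<Rightarrow> 'a set \<Rightarrow> bool" where
  "matroid_basis indep B \<longleftrightarrow> indep B \<and> (\<forall>X. indep X \<and> B \<subseteq> X \<longrightarrow> X = B)"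

definition circuits :: "'a set \<Rightarrow> ('a set \<Rightarrow> bool) \<Rightarrow> 'a set set" where
  "circuits E indep = {C. C \<subseteq> E \<and> \<not> indep C \<and> (\<forall>D. D \<subset> C \<longrightarrow> indep D)}"

text \<open>Independence in the dual matroid, whose bases are the complements of the bases.\<close>

definition dual_indep :: "'a set \<Rightarrow> ('a set \<Rightarrow> bool) \<Rightarrow> 'a set \<Rightarrow> bool" where
  "dual_indep E indep X \<longleftrightarrow> (\<exists>B. matroid_basis indep B \<and> X \<subseteq> E - B)"

definition cocircuits :: "'a set \<Rightarrow> ('a set \<Rightarrow> bool) \<Rightarrow> 'a set set" where
  "cocircuits E indep = circuits E (dual_indep E indep)"

definition cocircuit_matrix :: "'a \<Rightarrow> 'a set \<Rightarrow> real" where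
  "cocircuit_matrix i C = (if i \<in> C then 0 else 1)"

text \<open>The elements of the ground set are assigned vectors \<open>v e\<close> in some \<open>k\<^sup>n\<close>. Linear independence is
  that of the family \<open>(v e)\<^sub>e\<^sub>\<in>\<^sub>X\<close>, so repeated vectors are dependent.\<close>

definition representable :: "'k::field itself \<Rightarrow> 'a set \<Rightarrow> ('a set \<Rightarrow> bool) \<Rightarrow> bool" where
  "representable _ E indep \<longleftrightarrow>
     (\<exists>(n::nat) (v :: 'a \<Rightarrow> nat \<Rightarrow> 'k).
        (\<forall>e\<in>E. v e \<in> coord_space {..<n}) \<and>
        (\<forall>X\<subseteq>E. indep X \<longleftrightarrow> inj_on v X \<and> fvec.independent (v ` X)))"

end

theory Submission
  imports Defs "HOL-Computational_Algebra.Polynomial"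
begin

text \<open>
  Let \<open>r\<close> be the rank of the matroid. Everything rests on two observations.

  The first is combinatorial. Let \<open>G\<close> be a matrix over \<open>k\<close> whose rows are indexed by the ground set
  and whose columns are indexed by the cocircuits, with \<open>G e C\<close> nonzero exactly for \<open>e \<in> C\<close>. For an
  element \<open>x\<close> of a basis \<open>B\<close> there is a cocircuit that meets \<open>B\<close> only in \<open>x\<close>, so the rows of \<open>B\<close>
  contain a diagonal submatrix with nonzero diagonal, and independent sets have independent rows
  (\<open>indep_rows_no_relation\<close>). If moreover \<open>G\<close> has rank at most \<open>r\<close>, then its rows represent the
  matroid: were the rows of a dependent set \<open>X\<close> independent, a maximal independent subset \<open>I\<close> of
  \<open>X\<close> could be extended to a basis \<open>B\<close>, and the rows of \<open>X \<union> (B - I)\<close>, of which there are more than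
  \<open>r\<close>, would be independent as well (\<open>rows_represent_matroid\<close>).

  The second is that ranks do not grow under reduction. If a subspace of dimension \<open>n\<close> over the
  series field tropicalizes to a set that contains the columns of the cocircuit matrix, the lifted
  columns have no negative exponents, and their terms of exponent \<open>0\<close> form a matrix \<open>G\<close> as above.
  A linear relation between its lifted rows, divided by the lowest power of \<open>t\<close> that occurs in it,
  reduces to a nontrivial relation between the rows of \<open>G\<close> (\<open>reduce_linear_relation\<close>); so \<open>G\<close> has
  rank at most \<open>n\<close>. Hence \<open>n \<ge> r\<close> always (\<open>rank_le_dim\<close>), and \<open>n = r\<close> yields a representation
  (\<open>representable_if_dim_eq_rank\<close>).

  For the converse, let vectors \<open>v e\<close> represent the matroid. The complement of a cocircuit \<open>C\<close> is a
  hyperplane, so there is a linear functional \<open>\<phi> C\<close> with \<open>\<phi> C (v e)\<close> nonzero exactly for \<open>e \<in> C\<close>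
  (\<open>cocircuit_functional\<close>). As \<open>k\<close> is infinite, some vector \<open>w\<close> in the span of the \<open>v e\<close> lies in the
  kernel of none of these functionals (\<open>generic_coefficients\<close>). Then
  \<open>\<phi> C (v e + t w) = \<phi> C (v e) + t \<phi> C w\<close> has degree \<open>0\<close> if \<open>e \<in> C\<close> and degree \<open>1\<close> otherwise. The
  vectors \<open>v e + t w\<close> lie in a space of dimension \<open>r\<close>, so these columns span at most \<open>r\<close> dimensions
  (\<open>rank_dim_lift\<close>). Adding \<open>t w\<close> to all vectors treats loops, where \<open>v e = 0\<close>, like
  all other elements.
\<close>

section \<open>Linear relations between vectors of a coordinate space\<close>

lemma vscale_apply [simp]: "vscale c f i = c * f i"
  by (simp add: vscale_def)

lemma sum_apply: "(\<Sum>x\<in>X. f x) i = (\<Sum>x\<in>X. f x i)"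
  for f :: "'x \<Rightarrow> 'i \<Rightarrow> 'k::comm_monoid_add"
  by (induction X rule: infinite_finite_induct) auto

text \<open>Representability speaks of sets of vectors together with injectivity; all arguments below are
  about coefficient families, which this criterion makes available.\<close>

lemma independent_family_iff:
  fixes v :: "'x \<Rightarrow> 'i \<Rightarrow> 'k::field"
  assumes "finite X"
  shows "inj_on v X \<and> fvec.independent (v ` X) \<longleftrightarrow>
    (\<forall>c. (\<forall>i. (\<Sum>x\<in>X. c x * v x i) = 0) \<longrightarrow> (\<forall>x\<in>X. c x = 0))" (is "?L \<longleftrightarrow> ?R")
proof
  assume L: ?L
  show ?R
  proof (intro allI impI)
    fix c assume c: "\<forall>i. (\<Sum>x\<in>X. c x * v x i) = 0"
    let ?u = "\<lambda>y. c (the_inv_into X v y)"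
    have "(\<Sum>y\<in>v ` X. vscale (?u y) y) = (\<Sum>x\<in>X. vscale (c x) (v x))"
      using L by (subst sum.reindex) (auto simp: the_inv_into_f_f intro!: sum.cong)
    also have "\<dots> = 0" using c by (simp add: fun_eq_iff sum_apply)
    finally have "\<forall>y\<in>v ` X. ?u y = 0"
      using L assms fvec.independentD[of "v ` X" "v ` X" ?u] by blast
    then show "\<forall>x\<in>X. c x = 0" using L by (auto simp: the_inv_into_f_f)
  qed
next
  assume R: ?R
  have inj: "inj_on v X"
  proof (rule inj_onI, rule ccontr)
    fix x y assume xy: "x \<in> X" "y \<in> X" "v x = v y" "x \<noteq> y"
    \<comment> \<open>two equal vectors satisfy the relation \<open>v x - v y = 0\<close>\<close>
    let ?c = "\<lambda>z. if z = x then 1 else if z = y then -1 else (0::'k)"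
    have "(\<Sum>z\<in>X. ?c z * v z i) = 0" for i
    proof -
      have "(\<Sum>z\<in>X. ?c z * v z i) = (\<Sum>z\<in>{x, y}. ?c z * v z i)"
        using xy assms by (intro sum.mono_neutral_right) auto
      then show ?thesis using xy by simp
    qed
    then have "?c x = 0" using R[rule_format, of ?c x] xy by simp
    then show False by simp
  qed
  moreover have "fvec.independent (v ` X)"
  proof (rule fvec.independent_if_scalars_zero)
    show "finite (v ` X)" using assms by simp
    fix u y assume u: "(\<Sum>y\<in>v ` X. vscale (u y) y) = 0" and y: "y \<in> v ` X"
    then have "(\<Sum>x\<in>X. vscale (u (v x)) (v x)) = 0" using inj by (simp add: sum.reindex)
    then have "\<forall>i. (\<Sum>x\<in>X. u (v x) * v x i) = 0" by (simp add: fun_eq_iff sum_apply)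
    then have "\<forall>x\<in>X. u (v x) = 0" using R[rule_format, of "\<lambda>x. u (v x)"] by blast
    then show "u y = 0" using y by blast
  qed
  ultimately show ?L by blast
qed

lemma coord_space_subset_span:
  fixes I :: "'i set"
  assumes "finite I"
  obtains S :: "('i \<Rightarrow> 'k::field) set" where "finite S" "card S \<le> card I" "coord_space I \<subseteq> fvec.span S"
proof -
  let ?u = "\<lambda>i j. if j = i then 1 else (0::'k)"
  have "f \<in> fvec.span (?u ` I)" if "f \<in> coord_space I" for f :: "'i \<Rightarrow> 'k"
  proof -
    have "f = (\<Sum>i\<in>I. vscale (f i) (?u i))"
      using that assms by (auto simp: fun_eq_iff sum_apply coord_space_def if_distrib cong: if_cong)
    also have "\<dots> \<in> fvec.span (?u ` I)"
      by (intro fvec.span_sum fvec.span_scale fvec.span_base) auto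
    finally show ?thesis .
  qed
  then show ?thesis using that[of "?u ` I"] assms card_image_le[OF assms] by blast
qed

lemma linear_relation_if_card_gt:
  fixes w :: "'x \<Rightarrow> 'i \<Rightarrow> 'k::field"
  assumes I: "finite I" and X: "card I < card X" and w: "\<And>x. x \<in> X \<Longrightarrow> w x \<in> coord_space I"
  shows "\<exists>c. (\<exists>x\<in>X. c x \<noteq> 0) \<and> (\<forall>i. (\<Sum>x\<in>X. c x * w x i) = 0)"
proof (rule ccontr)
  assume no: "\<not> ?thesis"
  have fin: "finite X" using X card.infinite by fastforce
  from no have ind: "inj_on w X" "fvec.independent (w ` X)"
    using independent_family_iff[OF fin, of w] by blast+
  obtain S :: "('i \<Rightarrow> 'k) set" where S: "finite S" "card S \<le> card I" "coord_space I \<subseteq> fvec.span S"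
    using coord_space_subset_span[OF I] .
  have "card (w ` X) \<le> card S"
    using fvec.independent_span_bound[OF S(1) ind(2)] S(3) w by blast
  then show False using card_image[OF ind(1)] S(2) X by simp
qed

text \<open>Row rank is at most column rank. Fix a basis \<open>B\<close> of \<open>V\<close> and send each coordinate \<open>x\<close> to the
  vector of its values on \<open>B\<close>: these are more than \<open>card B\<close> vectors in a space of dimension
  \<open>card B\<close>, and a relation between them holds on all of \<open>V\<close>.\<close>

lemma coordinate_relation_on_subspace:
  fixes V :: "('i \<Rightarrow> 'k::field) set"
  assumes I: "finite I" "V \<subseteq> coord_space I" and X: "fvec.dim V < card X"
  shows "\<exists>c. (\<exists>x\<in>X. c x \<noteq> 0) \<and> (\<forall>f\<in>V. (\<Sum>x\<in>X. c x * f x) = 0)"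
proof -
  obtain B where B: "B \<subseteq> V" "fvec.independent B" "V \<subseteq> fvec.span B" "card B = fvec.dim V"
    by (rule fvec.basis_exists)
  obtain S :: "('i \<Rightarrow> 'k) set" where S: "finite S" "coord_space I \<subseteq> fvec.span S"
    using coord_space_subset_span[OF I(1)] by metis
  have fB: "finite B"
    using fvec.independent_span_bound[OF S(1) B(2)] B(1) I(2) S(2) by blast
  let ?w = "\<lambda>x b. if b \<in> B then b x else 0"
  have "\<exists>c. (\<exists>x\<in>X. c x \<noteq> 0) \<and> (\<forall>b. (\<Sum>x\<in>X. c x * ?w x b) = 0)"
    by (rule linear_relation_if_card_gt[OF fB]) (use X B(4) in \<open>auto simp: coord_space_def\<close>)
  then obtain c where c: "\<exists>x\<in>X. c x \<noteq> 0" "\<And>b. (\<Sum>x\<in>X. c x * ?w x b) = 0" by blast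
  have "(\<Sum>x\<in>X. c x * f x) = 0" if f: "f \<in> V" for f
  proof -
    have "f \<in> fvec.span B" using f B(3) by blast
    then show ?thesis
    proof (induction rule: fvec.span_induct_alt)
      case base then show ?case by simp
    next
      case (step a b y)
      have "(\<Sum>x\<in>X. c x * b x) = 0" using c(2)[of b] step by simp
      then show ?case
        using step by (simp add: distrib_left sum.distrib mult.left_commute[of _ a] flip: sum_distrib_left)
    qed
  qed
  then show ?thesis using c(1) by blast
qed


section \<open>Reduction of linear relations over the series field\<close>

lemma hahn_coeff_sum: "hahn_coeff (\<Sum>x\<in>X. f x) a = (\<Sum>x\<in>X. hahn_coeff (f x) a)"
  for f :: "'x \<Rightarrow> 'k::ab_group_add hahn"
  by (induction X rule: infinite_finite_induct) auto

text \<open>Of all ways to write \<open>d + e\<close> as a sum of two exponents, only \<open>d\<close> and \<open>e\<close> themselves survive.\<close>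

lemma hahn_coeff_times_lowest:
  fixes f g :: "'k::comm_ring_1 hahn"
  assumes f: "\<And>a. a < d \<Longrightarrow> hahn_coeff f a = 0" and g: "\<And>a. a < e \<Longrightarrow> hahn_coeff g a = 0"
  shows "hahn_coeff (f * g) (d + e) = hahn_coeff f d * hahn_coeff g e"
proof -
  have "hahn_coeff (f * g) (d + e) = (\<Sum>a\<in>{d}. hahn_coeff f a * hahn_coeff g (d + e - a))"
  proof (rule hahn_coeff_times, simp, rule subsetI)
    fix a assume "a \<in> {a \<in> hahn_supp f. d + e - a \<in> hahn_supp g}"
    then have "\<not> a < d" "\<not> d + e - a < e" using f g by (auto simp: hahn_supp_def)
    then show "a \<in> {d}" by simp
  qed
  then show ?thesis by simp
qed

text \<open>Let \<open>d\<close> be the lowest exponent occurring in the coefficients. As \<open>F\<close> has no negative exponents,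
  comparing the terms of exponent \<open>d\<close> in the relation gives a relation over \<open>k\<close> between the constant
  terms, and the choice of \<open>d\<close> makes it nontrivial.\<close>

lemma reduce_linear_relation:
  fixes F :: "'j \<Rightarrow> 'i \<Rightarrow> 'k::field hahn"
  assumes fin: "finite X" and c: "\<exists>x\<in>X. c x \<noteq> 0"
    and rel: "\<And>j. j \<in> J \<Longrightarrow> (\<Sum>x\<in>X. c x * F j x) = 0"
    and F: "\<And>j x a. j \<in> J \<Longrightarrow> x \<in> X \<Longrightarrow> a < 0 \<Longrightarrow> hahn_coeff (F j x) a = 0"
  shows "\<exists>c'. (\<exists>x\<in>X. c' x \<noteq> 0) \<and> (\<forall>j\<in>J. (\<Sum>x\<in>X. c' x * hahn_coeff (F j x) 0) = 0)"
proof -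
  let ?D = "(\<lambda>x. hahn_deg (c x)) ` {x\<in>X. c x \<noteq> 0}"
  define d where "d = Min ?D"
  have "d \<in> ?D" unfolding d_def using fin c by (intro Min_in) auto
  then obtain x0 where x0: "x0 \<in> X" "hahn_coeff (c x0) d \<noteq> 0" using hahn_deg_supp by blast
  have low: "hahn_coeff (c x) a = 0" if "x \<in> X" "a < d" for x a
  proof (rule ccontr)
    assume nz: "hahn_coeff (c x) a \<noteq> 0"
    then have "c x \<noteq> 0" by auto
    then have "d \<le> hahn_deg (c x)" unfolding d_def using fin that by (intro Min_le) auto
    then show False using hahn_deg_le[OF nz] that by simp
  qed
  have "(\<Sum>x\<in>X. hahn_coeff (c x) d * hahn_coeff (F j x) 0) = 0" if "j \<in> J" for j
  proof -
    have "(\<Sum>x\<in>X. hahn_coeff (c x) d * hahn_coeff (F j x) 0) = (\<Sum>x\<in>X. hahn_coeff (c x * F j x) (d + 0))"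
      using low F that by (intro sum.cong refl hahn_coeff_times_lowest[symmetric]) auto
    also have "\<dots> = hahn_coeff (\<Sum>x\<in>X. c x * F j x) d" by (simp add: hahn_coeff_sum)
    also have "\<dots> = 0" using rel that by simp
    finally show ?thesis .
  qed
  then show ?thesis using x0 by (intro exI[of _ "\<lambda>x. hahn_coeff (c x) d"]) blast
qed

lemma hahn_deg_eqI:
  assumes "hahn_coeff f d \<noteq> 0" "\<And>a. a < d \<Longrightarrow> hahn_coeff f a = 0"
  shows "hahn_deg f = d"
proof -
  have "f \<noteq> 0" using assms(1) by auto
  then show ?thesis
    using hahn_deg_supp[of f] hahn_deg_le[of f d] assms by (metis less_eq_real_def)
qed


section \<open>Generic linear combinations\<close>

text \<open>Finitely many nonzero functionals have a common point of nonvanishing on the moment curve: along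
  \<open>s \<mapsto> (s ^ h b)\<^sub>b\<close>, with distinct exponents \<open>h b\<close>, each of them is a nonzero polynomial in \<open>s\<close>.\<close>

lemma generic_coefficients:
  fixes g :: "'j \<Rightarrow> 'b \<Rightarrow> 'k::field"
  assumes inf: "infinite (UNIV :: 'k set)" and B: "finite B" and J: "finite J"
    and nz: "\<And>j. j \<in> J \<Longrightarrow> \<exists>b\<in>B. g j b \<noteq> 0"
  shows "\<exists>a. \<forall>j\<in>J. (\<Sum>b\<in>B. a b * g j b) \<noteq> 0"
proof -
  obtain h :: "'b \<Rightarrow> nat" where h: "inj_on h B" using B finite_imp_inj_to_nat_seg by blast
  define p where "p = (\<lambda>j. \<Sum>b\<in>B. monom (g j b) (h b))"
  have "p j \<noteq> 0" if j: "j \<in> J" for j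
  proof -
    obtain b where b: "b \<in> B" "g j b \<noteq> 0" using nz[OF j] by blast
    have "coeff (p j) (h b) = (\<Sum>b'\<in>B. if h b' = h b then g j b' else 0)"
      by (simp add: p_def coeff_sum)
    also have "\<dots> = (\<Sum>b'\<in>{b}. if h b' = h b then g j b' else 0)"
      using B b h by (intro sum.mono_neutral_right) (auto dest: inj_onD)
    finally show ?thesis using b by auto
  qed
  then have "finite (\<Union>j\<in>J. {s. poly (p j) s = 0})" using J by (simp add: poly_roots_finite)
  then obtain s where s: "s \<notin> (\<Union>j\<in>J. {s. poly (p j) s = 0})"
    using ex_new_if_finite[OF inf] by blast
  have "(\<Sum>b\<in>B. s ^ h b * g j b) \<noteq> 0" if "j \<in> J" for j
    using s that by (simp add: p_def poly_sum poly_monom mult.commute)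
  then show ?thesis by (intro exI[of _ "\<lambda>b. s ^ h b"] ballI)
qed


section \<open>Cocircuits and bases\<close>

text \<open>The complement of the hyperplane spanned by \<open>B - {x}\<close>. Elements of \<open>B - {x}\<close> have to be excluded
  explicitly because inserting them does not destroy independence.\<close>

definition fundamental_cocircuit :: "'a set \<Rightarrow> ('a set \<Rightarrow> bool) \<Rightarrow> 'a set \<Rightarrow> 'a \<Rightarrow> 'a set" where
  "fundamental_cocircuit E indep B x = {y \<in> E - (B - {x}). indep (insert y (B - {x}))}"

context matroid
begin

lemma finite_indep: "indep X \<Longrightarrow> finite X"
  using finite_ground indep_subset_ground finite_subset by blast

lemma finite_indeps: "finite {X. indep X}"
  by (rule finite_subset[of _ "Pow E"]) (use finite_ground indep_subset_ground in auto)

lemma card_le_rank: "indep X \<Longrightarrow> card X \<le> matroid_rank indep"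
  unfolding matroid_rank_def using finite_indeps by (intro Max_ge) auto

lemma extend_to_basis:
  assumes "indep X"
  obtains B where "X \<subseteq> B" "indep B" "card B = matroid_rank indep"
proof -
  have "matroid_rank indep \<in> card ` {X. indep X}"
    unfolding matroid_rank_def using finite_indeps indep_empty by (intro Max_in) auto
  then obtain Y where Y: "indep Y" "card Y = matroid_rank indep" by auto
  obtain B where B: "indep B" "X \<subseteq> B" "\<And>Z. indep Z \<Longrightarrow> B \<subseteq> Z \<Longrightarrow> B = Z"
    using finite_has_maximal2[OF finite_indeps, of X] assms by auto
  have "\<not> card B < card Y"
    using augmentation[OF B(1) Y(1)] B(3) by (metis Diff_iff insertI1 subset_insertI)
  then show ?thesis using that B card_le_rank Y(2) by (metis le_antisym not_le)
qed

lemma basis_iff: "matroid_basis indep B \<longleftrightarrow> indep B \<and> card B = matroid_rank indep"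
proof
  assume "matroid_basis indep B"
  then show "indep B \<and> card B = matroid_rank indep"
    unfolding matroid_basis_def by (metis extend_to_basis)
next
  assume B: "indep B \<and> card B = matroid_rank indep"
  have "X = B" if "indep X" "B \<subseteq> X" for X
    using that B card_le_rank[of X] card_seteq[OF finite_indep[of X], of B] by auto
  then show "matroid_basis indep B" using B unfolding matroid_basis_def by blast
qed

lemma dual_indep_iff:
  "X \<subseteq> E \<Longrightarrow> dual_indep E indep X \<longleftrightarrow> (\<exists>B. matroid_basis indep B \<and> B \<inter> X = {})"
  unfolding dual_indep_def by blast

lemma cocircuit_subset: "C \<in> cocircuits E indep \<Longrightarrow> C \<subseteq> E"
  by (simp add: cocircuits_def circuits_def)

lemma finite_cocircuits: "finite (cocircuits E indep)"
  by (rule finite_subset[of _ "Pow E"]) (use finite_ground cocircuit_subset in auto)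

lemma cocircuit_meets_basis:
  "C \<in> cocircuits E indep \<Longrightarrow> matroid_basis indep B \<Longrightarrow> B \<inter> C \<noteq> {}"
  by (auto simp: cocircuits_def circuits_def dual_indep_iff)

lemma exchange_basis:
  assumes "matroid_basis indep B" "x \<in> B" "y \<notin> B - {x}" "indep (insert y (B - {x}))"
  shows "matroid_basis indep (insert y (B - {x}))"
proof -
  have "finite B" "card B = matroid_rank indep" using assms(1) finite_indep by (auto simp: basis_iff)
  moreover have "card (insert y (B - {x})) = card B"
    using assms(2,3) \<open>finite B\<close> by (metis card.insert card.remove finite_Diff)
  ultimately show ?thesis using assms(4) by (simp add: basis_iff)
qed

text \<open>A basis \<open>B'\<close> cannot avoid this set, since augmenting \<open>B - {x}\<close> from \<open>B'\<close> picks an element of it.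
  It is minimal with this property: if \<open>y\<close> is removed, the basis obtained by exchanging \<open>x\<close> for \<open>y\<close>
  avoids what remains.\<close>

lemma fundamental_cocircuit_in_cocircuits:
  assumes B: "matroid_basis indep B" and x: "x \<in> B"
  shows "fundamental_cocircuit E indep B x \<in> cocircuits E indep" (is "?C \<in> _")
proof -
  have CE: "?C \<subseteq> E" by (auto simp: fundamental_cocircuit_def)
  have iB: "indep B" "card B = matroid_rank indep" using B by (auto simp: basis_iff)
  have "\<not> dual_indep E indep ?C"
  proof
    assume "dual_indep E indep ?C"
    then obtain B' where B': "matroid_basis indep B'" "B' \<inter> ?C = {}"
      using dual_indep_iff[OF CE] by blast
    have "indep (B - {x})" using iB(1) indep_subset by blast
    moreover have "card (B - {x}) < card B'"
      using B'(1) iB x finite_indep[OF iB(1)] by (metis basis_iff card_Diff1_less)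
    ultimately obtain y where "y \<in> B' - (B - {x})" "indep (insert y (B - {x}))"
      using augmentation B'(1) by (metis basis_iff)
    moreover have "B' \<subseteq> E" using B'(1) indep_subset_ground by (auto simp: basis_iff)
    ultimately show False using B'(2) by (auto simp: fundamental_cocircuit_def)
  qed
  moreover have "dual_indep E indep D" if D: "D \<subset> ?C" for D
  proof -
    obtain y where y: "y \<in> ?C" "y \<notin> D" using D by blast
    then have "matroid_basis indep (insert y (B - {x}))"
      using exchange_basis[OF B x] by (auto simp: fundamental_cocircuit_def)
    moreover have "insert y (B - {x}) \<inter> D = {}" using y D by (auto simp: fundamental_cocircuit_def)
    ultimately show ?thesis using dual_indep_iff D CE by blast
  qed
  ultimately show ?thesis using CE by (simp add: cocircuits_def circuits_def)
qed

text \<open>By minimality, for \<open>x \<in> C\<close> some basis \<open>B\<close> avoids \<open>C - {x}\<close>, and so meets \<open>C\<close> in \<open>x\<close> alone. Every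
  exchange of \<open>x\<close> for \<open>y\<close> gives a basis that must meet \<open>C\<close>, which forces \<open>y \<in> C\<close>; so \<open>C\<close> contains a
  fundamental cocircuit and is equal to it.\<close>

lemma cocircuit_is_fundamental:
  assumes C: "C \<in> cocircuits E indep"
  obtains B x where "matroid_basis indep B" "x \<in> B" "C = fundamental_cocircuit E indep B x"
proof -
  have "C \<noteq> {}"
  proof -
    obtain B where "indep B" "card B = matroid_rank indep"
      using extend_to_basis[OF indep_empty] by blast
    then show ?thesis using cocircuit_meets_basis[OF C, of B] basis_iff by blast
  qed
  then obtain x where x: "x \<in> C" by blast
  have "dual_indep E indep (C - {x})"
    using C x unfolding cocircuits_def circuits_def by blast
  then obtain B where B: "matroid_basis indep B" "B \<inter> (C - {x}) = {}"
    using dual_indep_iff[of "C - {x}"] cocircuit_subset[OF C] by blast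
  have xB: "x \<in> B" using cocircuit_meets_basis[OF C B(1)] B(2) by blast
  let ?C = "fundamental_cocircuit E indep B x"
  have "?C \<subseteq> C"
  proof
    fix y assume "y \<in> ?C"
    then have "matroid_basis indep (insert y (B - {x}))"
      using exchange_basis[OF B(1) xB] by (auto simp: fundamental_cocircuit_def)
    then show "y \<in> C" using cocircuit_meets_basis[OF C] B(2) by blast
  qed
  moreover have "\<not> ?C \<subset> C"
    using fundamental_cocircuit_in_cocircuits[OF B(1) xB] C
    unfolding cocircuits_def circuits_def by blast
  ultimately show ?thesis using that[OF B(1) xB] by blast
qed

lemma fundamental_cocircuit_inter_basis:
  assumes "matroid_basis indep B" "x \<in> B"
  shows "y \<in> B \<Longrightarrow> y \<in> fundamental_cocircuit E indep B x \<longleftrightarrow> y = x"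
  using assms indep_subset_ground
  by (auto simp: fundamental_cocircuit_def basis_iff insert_absorb)


section \<open>Matrices supported on the cocircuits\<close>

text \<open>The column of the fundamental cocircuit of \<open>x\<close> with respect to a basis containing \<open>X\<close> vanishes on
  all of \<open>X\<close> except \<open>x\<close>, and so isolates the coefficient of \<open>x\<close>.\<close>

lemma indep_rows_no_relation:
  fixes G :: "'a \<Rightarrow> 'a set \<Rightarrow> 'k::field"
  assumes G: "\<And>e C. e \<in> E \<Longrightarrow> C \<in> cocircuits E indep \<Longrightarrow> G e C \<noteq> 0 \<longleftrightarrow> e \<in> C"
    and X: "indep X" and c: "\<And>C. C \<in> cocircuits E indep \<Longrightarrow> (\<Sum>x\<in>X. c x * G x C) = 0"
  shows "\<forall>x\<in>X. c x = 0"
proof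
  fix x assume x: "x \<in> X"
  obtain B where B: "X \<subseteq> B" "matroid_basis indep B"
    using extend_to_basis[OF X] basis_iff by metis
  let ?C = "fundamental_cocircuit E indep B x"
  have xB: "x \<in> B" using x B by blast
  have C: "?C \<in> cocircuits E indep" by (rule fundamental_cocircuit_in_cocircuits[OF B(2) xB])
  have XE: "X \<subseteq> E" using X indep_subset_ground by blast
  have zero: "G y ?C = 0 \<longleftrightarrow> y \<noteq> x" if "y \<in> X" for y
    using G[OF _ C, of y] that XE B(1) fundamental_cocircuit_inter_basis[OF B(2) xB, of y] by blast
  have "(\<Sum>y\<in>X. c y * G y ?C) = (\<Sum>y\<in>{x}. c y * G y ?C)"
    using x zero finite_indep[OF X] by (intro sum.mono_neutral_right) auto
  then have "c x * G x ?C = 0" using c[OF C] by simp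
  then show "c x = 0" using zero[OF x] by simp
qed

text \<open>For the implication from independent rows to an independent set, suppose that \<open>X\<close> is dependent
  and extend a maximal independent subset \<open>I\<close> of \<open>X\<close> to a basis \<open>B\<close>. The set \<open>X \<union> (B - I)\<close> has more
  than \<open>r\<close> elements, hence a relation between its rows. The hyperplane spanned by \<open>B - {z}\<close>, for
  \<open>z \<in> B - I\<close>, contains \<open>I\<close> and therefore \<open>X\<close>; so the corresponding cocircuit isolates the coefficient
  of \<open>z\<close>. The relation thus lives on \<open>X\<close> alone.\<close>

lemma rows_represent_matroid:
  fixes G :: "'a \<Rightarrow> 'a set \<Rightarrow> 'k::field"
  assumes G: "\<And>e C. e \<in> E \<Longrightarrow> C \<in> cocircuits E indep \<Longrightarrow> G e C \<noteq> 0 \<longleftrightarrow> e \<in> C"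
    and rank: "\<And>Y. Y \<subseteq> E \<Longrightarrow> matroid_rank indep < card Y \<Longrightarrow>
      \<exists>c. (\<exists>x\<in>Y. c x \<noteq> 0) \<and> (\<forall>C\<in>cocircuits E indep. (\<Sum>x\<in>Y. c x * G x C) = 0)"
    and X: "X \<subseteq> E"
  shows "indep X \<longleftrightarrow>
    (\<forall>c. (\<forall>C\<in>cocircuits E indep. (\<Sum>x\<in>X. c x * G x C) = 0) \<longrightarrow> (\<forall>x\<in>X. c x = 0))"
proof
  show "indep X \<Longrightarrow>
    \<forall>c. (\<forall>C\<in>cocircuits E indep. (\<Sum>x\<in>X. c x * G x C) = 0) \<longrightarrow> (\<forall>x\<in>X. c x = 0)"
    using indep_rows_no_relation[OF G] by metis
next
  assume R: "\<forall>c. (\<forall>C\<in>cocircuits E indep. (\<Sum>x\<in>X. c x * G x C) = 0) \<longrightarrow> (\<forall>x\<in>X. c x = 0)"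
  show "indep X"
  proof (rule ccontr)
    assume dep: "\<not> indep X"
    have fX: "finite X" using X finite_ground finite_subset by blast
    have "finite {I. indep I \<and> I \<subseteq> X}" using finite_indeps by simp
    then obtain I where I: "indep I" "I \<subseteq> X"
      and max: "\<And>J. indep J \<Longrightarrow> J \<subseteq> X \<Longrightarrow> I \<subseteq> J \<Longrightarrow> I = J"
      using finite_has_maximal2[of "{I. indep I \<and> I \<subseteq> X}" "{}"] indep_empty by auto
    obtain B where B: "I \<subseteq> B" "indep B" "card B = matroid_rank indep"
      using extend_to_basis[OF I(1)] .
    have mB: "matroid_basis indep B" using B by (simp add: basis_iff)
    have fB: "finite B" by (rule finite_indep[OF B(2)])
    \<comment> \<open>the hyperplane spanned by \<open>B - {z}\<close> contains \<open>X\<close>\<close>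
    have avoid: "y = z \<or> y \<in> I" if "y \<in> X" "z \<in> B - I" "indep (insert y (B - {z}))" for y z
    proof -
      have "indep (insert y I)" by (rule indep_subset[OF that(3)]) (use that B in auto)
      then show ?thesis using max[of "insert y I"] that I by blast
    qed
    have disj: "X \<inter> (B - I) = {}"
    proof (rule ccontr)
      assume "X \<inter> (B - I) \<noteq> {}"
      then obtain y where y: "y \<in> X" "y \<in> B" "y \<notin> I" by blast
      have "indep (insert y I)" by (rule indep_subset[OF B(2)]) (use y B(1) in auto)
      then show False using max[of "insert y I"] y I(2) by blast
    qed
    let ?Y = "X \<union> (B - I)"
    have YE: "?Y \<subseteq> E" using X B(2) indep_subset_ground by blast
    have "I \<subset> X" using I dep by blast
    then have "card I < card X" using fX psubset_card_mono by blast
    moreover have "card ?Y = card X + (card B - card I)"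
      using fX fB disj B(1) finite_subset[OF B(1) fB]
      by (simp add: card_Un_disjoint card_Diff_subset)
    moreover have "card I \<le> card B" using B(1) fB card_mono by blast
    ultimately have "matroid_rank indep < card ?Y" using B(3) by simp
    then obtain c where c: "\<exists>x\<in>?Y. c x \<noteq> 0"
      "\<And>C. C \<in> cocircuits E indep \<Longrightarrow> (\<Sum>x\<in>?Y. c x * G x C) = 0"
      using rank[OF YE] by blast
    have zero: "c z = 0" if z: "z \<in> B - I" for z
    proof -
      let ?C = "fundamental_cocircuit E indep B z"
      have zB: "z \<in> B" using z by blast
      have C: "?C \<in> cocircuits E indep" by (rule fundamental_cocircuit_in_cocircuits[OF mB zB])
      have Giff: "G y ?C = 0 \<longleftrightarrow> y \<noteq> z" if y: "y \<in> ?Y" for y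
      proof (cases "y \<in> B")
        case True
        then show ?thesis
          using G[OF _ C, of y] y YE fundamental_cocircuit_inter_basis[OF mB zB, of y] by blast
      next
        case False
        then have "y \<in> X" "y \<noteq> z" "y \<notin> I" using y zB B(1) by auto
        then have "y \<notin> ?C" using avoid[OF _ z] by (auto simp: fundamental_cocircuit_def)
        then show ?thesis using G[OF _ C, of y] y YE \<open>y \<noteq> z\<close> by blast
      qed
      have "(\<Sum>y\<in>?Y. c y * G y ?C) = (\<Sum>y\<in>{z}. c y * G y ?C)"
        using z Giff fX fB by (intro sum.mono_neutral_right) auto
      then have "c z * G z ?C = 0" using c(2)[OF C] by simp
      then show ?thesis using Giff[of z] z by simp
    qed
    have "(\<Sum>x\<in>X. c x * G x C) = 0" if "C \<in> cocircuits E indep" for C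
    proof -
      have "(\<Sum>x\<in>?Y. c x * G x C) = (\<Sum>x\<in>X. c x * G x C)"
        using zero fX fB by (intro sum.mono_neutral_right) auto
      then show ?thesis using c(2)[OF that] by simp
    qed
    then have "\<forall>x\<in>X. c x = 0" using R by blast
    then show False using zero c(1) by blast
  qed
qed


section \<open>Tropical linear spaces through the columns of the cocircuit matrix\<close>

lemma lift_of_cocircuit_matrix:
  fixes V :: "('a \<Rightarrow> 'k::field hahn) set"
  assumes "\<forall>C\<in>cocircuits E indep. (\<lambda>i\<in>E. cocircuit_matrix i C) \<in> tropicalization E V"
  obtains F where "\<And>C. C \<in> cocircuits E indep \<Longrightarrow> F C \<in> V"
    and "\<And>C e a. C \<in> cocircuits E indep \<Longrightarrow> e \<in> E \<Longrightarrow> a < 0 \<Longrightarrow> hahn_coeff (F C e) a = 0"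
    and "\<And>C e. C \<in> cocircuits E indep \<Longrightarrow> e \<in> E \<Longrightarrow> hahn_coeff (F C e) 0 \<noteq> 0 \<longleftrightarrow> e \<in> C"
proof -
  have "\<exists>f. f \<in> V \<and> (\<forall>e\<in>E. f e \<noteq> 0 \<and> hahn_deg (f e) = cocircuit_matrix e C)"
    if C: "C \<in> cocircuits E indep" for C
  proof -
    obtain f where f: "f \<in> V" "\<forall>i\<in>E. f i \<noteq> 0"
      "(\<lambda>i\<in>E. cocircuit_matrix i C) = (\<lambda>i\<in>E. hahn_deg (f i))"
      using bspec[OF assms C] unfolding tropicalization_def by (elim CollectE exE conjE)
    have "hahn_deg (f e) = cocircuit_matrix e C" if "e \<in> E" for e
      using fun_cong[OF f(3), of e] that by simp
    then show ?thesis using f by blast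
  qed
  then obtain F where F: "\<And>C. C \<in> cocircuits E indep \<Longrightarrow> F C \<in> V"
    "\<And>C e. C \<in> cocircuits E indep \<Longrightarrow> e \<in> E \<Longrightarrow>
      F C e \<noteq> 0 \<and> hahn_deg (F C e) = cocircuit_matrix e C" by metis
  have low: "hahn_coeff (F C e) a = 0"
    if "C \<in> cocircuits E indep" "e \<in> E" "a < cocircuit_matrix e C" for C e a
    using F(2)[OF that(1,2)] hahn_deg_le[of "F C e" a] that(3) by fastforce
  have ge: "0 \<le> cocircuit_matrix e C" for e and C :: "'a set"
    by (simp add: cocircuit_matrix_def)
  show ?thesis
  proof (rule that)
    fix C e assume Ce: "C \<in> cocircuits E indep" "e \<in> E"
    show "hahn_coeff (F C e) a = 0" if "a < 0" for a
      using low[OF Ce] that ge[of e C] by simp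
    show "hahn_coeff (F C e) 0 \<noteq> 0 \<longleftrightarrow> e \<in> C"
      using low[OF Ce, of 0] F(2)[OF Ce] hahn_deg_supp[of "F C e"]
      by (auto simp: cocircuit_matrix_def split: if_splits)
  qed (rule F(1))
qed

text \<open>Row rank does not grow on passing from the lifted columns, which span at most \<open>dim V\<close>
  dimensions, to their constant terms.\<close>

lemma relation_between_constant_terms:
  fixes V :: "('a \<Rightarrow> 'k::field hahn) set"
  assumes V: "V \<subseteq> coord_space E" and Y: "Y \<subseteq> E" "fvec.dim V < card Y"
    and F: "\<And>C. C \<in> J \<Longrightarrow> F C \<in> V"
      "\<And>C e a. C \<in> J \<Longrightarrow> e \<in> E \<Longrightarrow> a < 0 \<Longrightarrow> hahn_coeff (F C e) a = 0"
  shows "\<exists>c. (\<exists>x\<in>Y. c x \<noteq> 0) \<and> (\<forall>C\<in>J. (\<Sum>x\<in>Y. c x * hahn_coeff (F C x) 0) = 0)"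
proof -
  obtain c where c: "\<exists>x\<in>Y. c x \<noteq> 0" "\<forall>f\<in>V. (\<Sum>x\<in>Y. c x * f x) = 0"
    using coordinate_relation_on_subspace[OF finite_ground V Y(2)] by blast
  show ?thesis
    by (rule reduce_linear_relation[OF _ c(1)])
      (use finite_subset[OF Y(1) finite_ground] c(2) F Y(1) in auto)
qed

lemma rank_le_dim:
  assumes L: "tropical_linear_space TYPE('k::field) E n L"
    and cols: "\<forall>C\<in>cocircuits E indep. (\<lambda>i\<in>E. cocircuit_matrix i C) \<in> L"
  shows "matroid_rank indep \<le> n"
proof (rule ccontr)
  assume lt: "\<not> ?thesis"
  obtain V :: "('a \<Rightarrow> 'k hahn) set" where V: "V \<subseteq> coord_space E" "fvec.dim V = n"
    "L = tropicalization E V" using L unfolding tropical_linear_space_def by blast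
  obtain F where F: "\<And>C. C \<in> cocircuits E indep \<Longrightarrow> F C \<in> V"
    "\<And>C e a. C \<in> cocircuits E indep \<Longrightarrow> e \<in> E \<Longrightarrow> a < 0 \<Longrightarrow> hahn_coeff (F C e) a = 0"
    "\<And>C e. C \<in> cocircuits E indep \<Longrightarrow> e \<in> E \<Longrightarrow> hahn_coeff (F C e) 0 \<noteq> 0 \<longleftrightarrow> e \<in> C"
    using lift_of_cocircuit_matrix[of V] cols V(3) by blast
  obtain B where B: "indep B" "card B = matroid_rank indep"
    using extend_to_basis[OF indep_empty] by blast
  have "\<exists>c. (\<exists>x\<in>B. c x \<noteq> 0) \<and> (\<forall>C\<in>cocircuits E indep. (\<Sum>x\<in>B. c x * hahn_coeff (F C x) 0) = 0)"
    by (rule relation_between_constant_terms[OF V(1) indep_subset_ground[OF B(1)] _ F(1,2)])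
      (use lt B(2) V(2) in auto)
  then show False
    using indep_rows_no_relation[of "\<lambda>e C. hahn_coeff (F C e) 0", OF F(3) B(1)] by blast
qed

lemma representable_if_dim_eq_rank:
  assumes L: "tropical_linear_space TYPE('k::field) E (matroid_rank indep) L"
    and cols: "\<forall>C\<in>cocircuits E indep. (\<lambda>i\<in>E. cocircuit_matrix i C) \<in> L"
  shows "representable TYPE('k) E indep"
proof -
  obtain V :: "('a \<Rightarrow> 'k hahn) set" where V: "V \<subseteq> coord_space E" "fvec.dim V = matroid_rank indep"
    "L = tropicalization E V" using L unfolding tropical_linear_space_def by blast
  obtain F where F: "\<And>C. C \<in> cocircuits E indep \<Longrightarrow> F C \<in> V"
    "\<And>C e a. C \<in> cocircuits E indep \<Longrightarrow> e \<in> E \<Longrightarrow> a < 0 \<Longrightarrow> hahn_coeff (F C e) a = 0"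
    "\<And>C e. C \<in> cocircuits E indep \<Longrightarrow> e \<in> E \<Longrightarrow> hahn_coeff (F C e) 0 \<noteq> 0 \<longleftrightarrow> e \<in> C"
    using lift_of_cocircuit_matrix[of V] cols V(3) by blast
  define n where "n = card (cocircuits E indep)"
  obtain h where h: "bij_betw h {..<n} (cocircuits E indep)"
    using ex_bij_betw_nat_finite[OF finite_cocircuits] unfolding n_def atLeast0LessThan by blast
  define v where "v = (\<lambda>e j. if j < n then hahn_coeff (F (h j) e) 0 else 0)"
  have "indep X \<longleftrightarrow> inj_on v X \<and> fvec.independent (v ` X)" if X: "X \<subseteq> E" for X
  proof -
    have "(\<forall>C\<in>cocircuits E indep. P C) \<longleftrightarrow> (\<forall>j<n. P (h j))" for P
      unfolding bij_betw_imp_surj_on[OF h, symmetric] by auto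
    moreover have "(\<Sum>x\<in>X. c x * v x j) =
        (if j < n then \<Sum>x\<in>X. c x * hahn_coeff (F (h j) x) 0 else 0)" for c j
      by (simp add: v_def)
    ultimately have "(\<forall>C\<in>cocircuits E indep. (\<Sum>x\<in>X. c x * hahn_coeff (F C x) 0) = 0) \<longleftrightarrow>
        (\<forall>j. (\<Sum>x\<in>X. c x * v x j) = 0)" for c
      by simp
    moreover have "indep X \<longleftrightarrow> (\<forall>c. (\<forall>C\<in>cocircuits E indep.
        (\<Sum>x\<in>X. c x * hahn_coeff (F C x) 0) = 0) \<longrightarrow> (\<forall>x\<in>X. c x = 0))"
      by (rule rows_represent_matroid[OF F(3) _ X],
          simp, simp, rule relation_between_constant_terms[OF V(1) _ _ F(1,2)])
        (use V(2) in auto)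
    ultimately show ?thesis
      using independent_family_iff[of X v] finite_subset[OF X finite_ground] by simp
  qed
  then show ?thesis unfolding representable_def
    by (intro exI[of _ n] exI[of _ v]) (auto simp: v_def coord_space_def)
qed

text \<open>Tropical linear spaces through the columns exist, so the least dimension that defines the
  Kapranov rank is attained: the whole space contains every point, by lifting its coordinates to
  monomials.\<close>

lemma exists_tropical_linear_space:
  "\<exists>n L. tropical_linear_space TYPE('k::field) E n L \<and>
    (\<forall>C\<in>cocircuits E indep. (\<lambda>i\<in>E. cocircuit_matrix i C) \<in> L)"
proof -
  let ?V = "coord_space E :: ('a \<Rightarrow> 'k hahn) set"
  have "(\<lambda>i\<in>E. cocircuit_matrix i C) \<in> tropicalization E ?V" for C :: "'a set"
  proof -
    let ?f = "\<lambda>i. if i \<in> E then hahn_monom (1::'k) (cocircuit_matrix i C) else 0"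
    have deg: "hahn_deg (hahn_monom (1::'k) d) = d" for d
      by (rule hahn_deg_eqI) (auto simp: hahn_monom.rep_eq)
    have nz: "hahn_monom (1::'k) d \<noteq> 0" for d
      by (metis hahn_monom.rep_eq zero_hahn.rep_eq zero_neq_one)
    show ?thesis unfolding tropicalization_def
      by (rule CollectI, rule exI[of _ ?f]) (auto simp: coord_space_def deg nz restrict_def)
  qed
  moreover have "fvec.subspace ?V"
    by (auto simp: fvec.subspace_def coord_space_def)
  ultimately show ?thesis unfolding tropical_linear_space_def by blast
qed


section \<open>Lifting a representation\<close>

lemma basis_spans:
  fixes v :: "'a \<Rightarrow> nat \<Rightarrow> 'k::field"
  assumes rep: "\<And>X. X \<subseteq> E \<Longrightarrow> indep X \<longleftrightarrow> inj_on v X \<and> fvec.independent (v ` X)"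
    and B: "matroid_basis indep B" and e: "e \<in> E"
  shows "v e \<in> fvec.span (v ` B)"
proof (rule ccontr)
  assume out: "v e \<notin> fvec.span (v ` B)"
  have iB: "indep B" using B by (simp add: basis_iff)
  then have BE: "B \<subseteq> E" by (rule indep_subset_ground)
  have ve: "v e \<notin> v ` B" using out fvec.span_base by blast
  then have "inj_on v (insert e B)" "fvec.independent (v ` insert e B)"
    using rep[OF BE] iB out by (auto simp: fvec.independent_insert)
  then have "indep (insert e B)" using rep[of "insert e B"] BE e by blast
  then have "insert e B = B" using B unfolding matroid_basis_def by blast
  then show False using ve by blast
qed

text \<open>If \<open>C\<close> is the fundamental cocircuit of \<open>x\<close> with respect to \<open>B\<close>, take the coordinate of \<open>v x\<close> with
  respect to the basis \<open>v ` B\<close>: it vanishes exactly on the span of \<open>v ` (B - {x})\<close>. Linearity is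
  only stated on combinations of the vectors \<open>v e\<close>, as outside their span coordinates
  default to \<open>0\<close>.\<close>

lemma cocircuit_functional:
  fixes v :: "'a \<Rightarrow> nat \<Rightarrow> 'k::field"
  assumes rep: "\<And>X. X \<subseteq> E \<Longrightarrow> indep X \<longleftrightarrow> inj_on v X \<and> fvec.independent (v ` X)"
    and C: "C \<in> cocircuits E indep"
  shows "\<exists>\<phi>. (\<forall>e\<in>E. \<phi> (v e) \<noteq> 0 \<longleftrightarrow> e \<in> C) \<and>
    (\<forall>B c. B \<subseteq> E \<longrightarrow> \<phi> (\<Sum>b\<in>B. vscale (c b) (v b)) = (\<Sum>b\<in>B. c b * \<phi> (v b)))"
proof -
  obtain B x where B: "matroid_basis indep B" and x: "x \<in> B"
    and C_eq: "C = fundamental_cocircuit E indep B x"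
    using cocircuit_is_fundamental[OF C] .
  have iB: "indep B" using B by (simp add: basis_iff)
  then have BE: "B \<subseteq> E" by (rule indep_subset_ground)
  have inj: "inj_on v B" and ind: "fvec.independent (v ` B)" using rep[OF BE] iB by auto
  have span: "v e \<in> fvec.span (v ` B)" if "e \<in> E" for e
    by (rule basis_spans[OF rep B that])
  define \<phi> where "\<phi> = (\<lambda>u. fvec.representation (v ` B) u (v x))"
  have lin: "\<phi> (\<Sum>b\<in>A. vscale (c b) (v b)) = (\<Sum>b\<in>A. c b * \<phi> (v b))" if A: "A \<subseteq> E" for A c
  proof -
    have "\<phi> (\<Sum>b\<in>A. vscale (c b) (v b)) = (\<Sum>b\<in>A. \<phi> (vscale (c b) (v b)))"
      unfolding \<phi>_def using A span by (subst fvec.representation_sum[OF ind]) (auto intro!: fvec.span_scale)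
    also have "\<dots> = (\<Sum>b\<in>A. c b * \<phi> (v b))"
      unfolding \<phi>_def using A span by (intro sum.cong refl) (subst fvec.representation_scale[OF ind], auto)
    finally show ?thesis .
  qed
  let ?S = "v ` (B - {x})"
  have indS: "fvec.independent ?S" by (rule fvec.independent_mono[OF ind]) auto
  have xS: "v x \<notin> ?S" using inj x by (auto dest: inj_onD)
  have vB: "v ` B = insert (v x) ?S" using x by auto
  have nz: "\<phi> (v e) \<noteq> 0 \<longleftrightarrow> v e \<notin> fvec.span ?S" if e: "e \<in> E" for e
  proof
    assume nz: "\<phi> (v e) \<noteq> 0"
    show "v e \<notin> fvec.span ?S"
    proof
      assume "v e \<in> fvec.span ?S"
      then have "fvec.representation (v ` B) (v e) = fvec.representation ?S (v e)"
        by (rule fvec.representation_extend[OF ind]) auto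
      then show False using nz fvec.representation_ne_zero[of ?S "v e" "v x"] xS by (simp add: \<phi>_def)
    qed
  next
    assume out: "v e \<notin> fvec.span ?S"
    show "\<phi> (v e) \<noteq> 0"
    proof
      assume 0: "\<phi> (v e) = 0"
      have fin: "finite (v ` B)" using finite_indep[OF iB] by simp
      have "v e = (\<Sum>y\<in>v ` B. vscale (fvec.representation (v ` B) (v e) y) y)"
        by (rule fvec.sum_representation_eq[OF ind span[OF e] fin order_refl, symmetric])
      also have "\<dots> = (\<Sum>y\<in>?S. vscale (fvec.representation (v ` B) (v e) y) y)"
        using 0 fin by (intro sum.mono_neutral_right) (auto simp: \<phi>_def vscale_def zero_fun_def)
      also have "\<dots> \<in> fvec.span ?S" by (intro fvec.span_sum fvec.span_scale fvec.span_base)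
      finally show False using out by blast
    qed
  qed
  have "\<phi> (v e) \<noteq> 0 \<longleftrightarrow> e \<in> C" if e: "e \<in> E" for e
  proof (cases "e \<in> B - {x}")
    case True
    then have "v e \<in> fvec.span ?S" by (intro fvec.span_base) blast
    then show ?thesis using nz[OF e] True by (auto simp: C_eq fundamental_cocircuit_def)
  next
    case False
    have "e \<in> C \<longleftrightarrow> indep (insert e (B - {x}))"
      using False e by (auto simp: C_eq fundamental_cocircuit_def)
    also have "\<dots> \<longleftrightarrow> inj_on v (insert e (B - {x})) \<and> fvec.independent (insert (v e) ?S)"
      using rep[of "insert e (B - {x})"] e BE by auto
    also have "\<dots> \<longleftrightarrow> v e \<notin> fvec.span ?S"
      using False inj indS fvec.span_base[of "v e" ?S]
      by (auto simp: fvec.independent_insert inj_on_diff inj_on_insert)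
    finally show ?thesis using nz[OF e] by blast
  qed
  then show ?thesis using lin by blast
qed

text \<open>Write \<open>v e\<close> as the sum of the \<open>c e b * v b\<close> over a basis \<open>B\<close>, and let \<open>w\<close> be the sum of the
  \<open>a b * v b\<close> for generic \<open>a\<close>. Then \<open>\<phi> C (v e + t w)\<close> is the sum of the
  \<open>\<phi> C (v b) * (c e b + a b * t)\<close>. So the columns \<open>f C\<close> of the lift are combinations of the \<open>r\<close> vectors
  \<open>u b\<close> with entries \<open>c e b + a b * t\<close>.\<close>

lemma rank_dim_lift:
  fixes v :: "'a \<Rightarrow> nat \<Rightarrow> 'k::field"
  assumes inf: "infinite (UNIV :: 'k set)"
    and rep: "\<And>X. X \<subseteq> E \<Longrightarrow> indep X \<longleftrightarrow> inj_on v X \<and> fvec.independent (v ` X)"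
  obtains n L where "n \<le> matroid_rank indep" "tropical_linear_space TYPE('k) E n L"
    "\<forall>C\<in>cocircuits E indep. (\<lambda>i\<in>E. cocircuit_matrix i C) \<in> L"
proof -
  obtain B where iB: "indep B" and cB: "card B = matroid_rank indep"
    using extend_to_basis[OF indep_empty] by blast
  have B: "matroid_basis indep B" using iB cB by (simp add: basis_iff)
  have fB: "finite B" and BE: "B \<subseteq> E" using iB finite_indep indep_subset_ground by auto
  have inj: "inj_on v B" using rep[OF BE] iB by blast
  have "\<exists>c. v e = (\<Sum>b\<in>B. vscale (c b) (v b))" if e: "e \<in> E" for e
  proof -
    obtain u where "v e = (\<Sum>y\<in>v ` B. vscale (u y) y)"
      using basis_spans[OF rep B e] fB by (auto simp: fvec.span_finite)
    then show ?thesis using inj by (intro exI[of _ "\<lambda>b. u (v b)"]) (simp add: sum.reindex)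
  qed
  then obtain c where c: "\<And>e. e \<in> E \<Longrightarrow> v e = (\<Sum>b\<in>B. vscale (c e b) (v b))" by metis
  have "\<forall>C\<in>cocircuits E indep. \<exists>\<phi>. (\<forall>e\<in>E. \<phi> (v e) \<noteq> 0 \<longleftrightarrow> e \<in> C) \<and>
      (\<forall>A c. A \<subseteq> E \<longrightarrow> \<phi> (\<Sum>b\<in>A. vscale (c b) (v b)) = (\<Sum>b\<in>A. c b * \<phi> (v b)))"
    by (intro ballI cocircuit_functional rep)
  from bchoice[OF this] obtain \<phi>
    where *: "\<forall>C\<in>cocircuits E indep. (\<forall>e\<in>E. \<phi> C (v e) \<noteq> 0 \<longleftrightarrow> e \<in> C) \<and>
      (\<forall>A c. A \<subseteq> E \<longrightarrow> \<phi> C (\<Sum>b\<in>A. vscale (c b) (v b)) = (\<Sum>b\<in>A. c b * \<phi> C (v b)))" ..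
  have \<phi>: "\<phi> C (v e) \<noteq> 0 \<longleftrightarrow> e \<in> C" if "C \<in> cocircuits E indep" "e \<in> E" for C e
    using bspec[OF * that(1)] that(2) by (elim conjE bspec)
  have lin: "\<phi> C (\<Sum>b\<in>A. vscale (c b) (v b)) = (\<Sum>b\<in>A. c b * \<phi> C (v b))"
    if "C \<in> cocircuits E indep" "A \<subseteq> E" for C A c
    using bspec[OF * that(1)] that(2) by simp
  have "\<exists>b\<in>B. \<phi> C (v b) \<noteq> 0" if C: "C \<in> cocircuits E indep" for C
    using cocircuit_meets_basis[OF C B] \<phi>[OF C] BE by blast
  then obtain a where a: "\<And>C. C \<in> cocircuits E indep \<Longrightarrow> (\<Sum>b\<in>B. a b * \<phi> C (v b)) \<noteq> 0"
    using generic_coefficients[OF inf fB finite_cocircuits, of "\<lambda>C b. \<phi> C (v b)"] by blast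
  define u where "u = (\<lambda>b e. if e \<in> E then hahn_monom (c e b) 0 + hahn_monom (a b) 1 else 0)"
  define f where "f = (\<lambda>C. \<Sum>b\<in>B. vscale (hahn_monom (\<phi> C (v b)) 0) (u b))"
  let ?V = "fvec.span (u ` B)"
  have coeff: "hahn_coeff (f C e) d =
      (if d = 0 then \<phi> C (v e) else if d = 1 then \<Sum>b\<in>B. a b * \<phi> C (v b) else 0)"
    if C: "C \<in> cocircuits E indep" and e: "e \<in> E" for C e d
  proof -
    have "hahn_coeff (f C e) d =
        (\<Sum>b\<in>B. \<phi> C (v b) * ((if d = 0 then c e b else 0) + (if d = 1 then a b else 0)))"
      using e by (simp add: f_def u_def sum_apply hahn_coeff_sum hahn_coeff_monom_times hahn_monom.rep_eq)
    moreover have "\<phi> C (v e) = (\<Sum>b\<in>B. \<phi> C (v b) * c e b)"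
      using lin[OF C BE, of "c e"] c[OF e] by (simp add: mult.commute)
    ultimately show ?thesis by (simp add: mult.commute)
  qed
  have "(\<lambda>i\<in>E. cocircuit_matrix i C) \<in> tropicalization E ?V" if C: "C \<in> cocircuits E indep" for C
  proof -
    have deg: "hahn_deg (f C e) = cocircuit_matrix e C" if e: "e \<in> E" for e
      using a[OF C] \<phi>[OF C e]
      by (intro hahn_deg_eqI) (auto simp: coeff[OF C e] cocircuit_matrix_def split: if_splits)
    have nz: "f C e \<noteq> 0" if e: "e \<in> E" for e
      using a[OF C] coeff[OF C e, of 1] by auto
    have "f C \<in> ?V" unfolding f_def by (intro fvec.span_sum fvec.span_scale fvec.span_base imageI)
    then show ?thesis unfolding tropicalization_def
      by (intro CollectI exI[of _ "f C"]) (auto simp: deg nz restrict_def)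
  qed
  then have cols: "\<forall>C\<in>cocircuits E indep. (\<lambda>i\<in>E. cocircuit_matrix i C) \<in> tropicalization E ?V"
    by blast
  have "?V \<subseteq> coord_space E"
    by (rule fvec.span_minimal) (auto simp: u_def coord_space_def fvec.subspace_def)
  then have trop: "tropical_linear_space TYPE('k) E (fvec.dim ?V) (tropicalization E ?V)"
    unfolding tropical_linear_space_def by (intro exI[of _ ?V] conjI refl fvec.subspace_span)
  have "fvec.dim ?V \<le> matroid_rank indep"
    using fvec.dim_le_card[of ?V "u ` B"] card_image_le[OF fB, of u] fB cB by simp
  then show thesis using trop cols by (rule that)
qed

end

theorem theorem7p3:
  fixes E :: "'a set" and indep :: "'a set \<Rightarrow> bool"
  assumes "matroid E indep"
  shows "(kapranov_rank TYPE('k::field) E (cocircuits E indep) cocircuit_matrix = matroid_rank indep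
           \<longrightarrow> representable TYPE('k) E indep) \<and>
         (infinite (UNIV :: 'k set) \<longrightarrow> representable TYPE('k) E indep
           \<longrightarrow> kapranov_rank TYPE('k) E (cocircuits E indep) cocircuit_matrix = matroid_rank indep)"
proof -
  interpret matroid E indep by (rule assms)
  let ?P = "\<lambda>n. \<exists>L. tropical_linear_space TYPE('k) E n L \<and>
    (\<forall>C\<in>cocircuits E indep. (\<lambda>i\<in>E. cocircuit_matrix i C) \<in> L)"
  let ?\<kappa> = "kapranov_rank TYPE('k) E (cocircuits E indep) cocircuit_matrix"
  have \<kappa>: "?\<kappa> = (LEAST n. ?P n)" by (simp only: kapranov_rank_def)
  have "?P ?\<kappa>" unfolding \<kappa> by (rule LeastI_ex) (rule exists_tropical_linear_space)
  then obtain L where L: "tropical_linear_space TYPE('k) E ?\<kappa> L"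
    and cols: "\<forall>C\<in>cocircuits E indep. (\<lambda>i\<in>E. cocircuit_matrix i C) \<in> L" by (elim exE conjE)
  show ?thesis
  proof (intro conjI impI)
    assume eq: "?\<kappa> = matroid_rank indep"
    show "representable TYPE('k) E indep"
      by (rule representable_if_dim_eq_rank[OF L[unfolded eq] cols])
  next
    assume inf: "infinite (UNIV :: 'k set)" and "representable TYPE('k) E indep"
    then obtain v :: "'a \<Rightarrow> nat \<Rightarrow> 'k"
      where rep: "\<And>X. X \<subseteq> E \<Longrightarrow> indep X \<longleftrightarrow> inj_on v X \<and> fvec.independent (v ` X)"
      unfolding representable_def by blast
    obtain n L' where n: "n \<le> matroid_rank indep" "tropical_linear_space TYPE('k) E n L'"
      "\<forall>C\<in>cocircuits E indep. (\<lambda>i\<in>E. cocircuit_matrix i C) \<in> L'"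
      by (rule rank_dim_lift[OF inf rep])
    have "?P n" using n(2,3) by (intro exI conjI)
    then have "?\<kappa> \<le> n" unfolding \<kappa> by (rule Least_le)
    moreover have "matroid_rank indep \<le> ?\<kappa>" by (rule rank_le_dim[OF L cols])
    ultimately show "?\<kappa> = matroid_rank indep" using n(1) by simp
  qed
qed

end
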